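(* Let $P_n$ denote the path graph on $n$ vertices. Then, for integers $\ell \ge 0$, $$Z^+_{(\ell)}(P_n) = \begin{cases} 1 & \text{if } \ell = 0,\\ 2 & \text{if } \ell = 1,\\ n & \text{if } \ell \ge 2.\end{cases}$$
   Context: All graphs are finite, simple and undirected. Positive semidefinite (psd) color change rule: given the current set $B$ of blue vertices of a graph $G$, let $W_1,\dots,W_k$ be the vertex sets of the connected components of $G-B$. If $u\in B$ and $w\in W_i$ is the only non-blue neighbor of $u$ in the induced subgraph $G[W_i\cup B]$, then $u$ may force $w$ (written $u\to w$), and $w$ becomes blue. The rule is applied iteratively, with the components recomputed from the current blue set. A leak is a vertex that is not allowed to perform any force. For an integer $\ell\ge 0$, a set $B\subseteq V(G)$ is an $\ell$-leaky positive semidefinite forcing set of $G$ if, for every choice of $\ell$ vertices as leaks (all vertices being leaks if $\ell\ge |V(G)|$; leaks are chosen after $B$ is fixed and may be inside or outside $B$), starting with exactly $B$ blue, iterated application of the psd color change rule, with forces performed only by non-leak vertices, colors all of $V(G)$ blue. The $\ell$-leaky positive semidefinite forcing number $Z^+_{(\ell)}(G)$ is the minimum cardinality of an $\ell$-leaky positive semidefinite forcing set of $G$.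
   Formalization: The formal theorem takes n ≥ 1 and, for ℓ = 1, requires n ≥ 2: the printed formula fails for n = ℓ = 1, since the single vertex of P_1 is itself a 1-leaky forcing set, so Z^+_(1)(P_1) = 1 and not 2. *)

theory Defs
  imports "Graph_Theory.Digraph_Component"
begin

(* Finite simple undirected graphs are the locale graph: finite, loop-free, symmetric digraphs
   without parallel arcs. In such a digraph the strongly connected components are the connected
   components, and the neighbours of u are the x with (u, x) in arcs_ends. *)

definition components_outside :: "('a, 'b) pre_digraph \<Rightarrow> 'a set \<Rightarrow> 'a set set" where
  "components_outside G B = pre_digraph.sccs_verts (G \<restriction> (verts G - B))"

definition psd_force :: "('a, 'b) pre_digraph \<Rightarrow> 'a set \<Rightarrow> 'a \<Rightarrow> 'a \<Rightarrow> bool" where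
  "psd_force G B u w \<longleftrightarrow>
     u \<in> B \<and>
     (\<exists>W \<in> components_outside G B. w \<in> W \<and>
        {x. u \<rightarrow>\<^bsub>G \<restriction> (W \<union> B)\<^esub> x \<and> x \<notin> B} = {w})"

definition leaky_psd_step :: "('a, 'b) pre_digraph \<Rightarrow> 'a set \<Rightarrow> 'a set \<Rightarrow> 'a set \<Rightarrow> bool" where
  "leaky_psd_step G L B B' \<longleftrightarrow>
     (\<exists>u w. u \<notin> L \<and> psd_force G B u w \<and> B' = insert w B)"

(* The minimum makes every vertex a leak when l is at least the number of vertices. *)
definition leaky_psd_forcing_set :: "('a, 'b) pre_digraph \<Rightarrow> nat \<Rightarrow> 'a set \<Rightarrow> bool" where
  "leaky_psd_forcing_set G l B \<longleftrightarrow>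
     B \<subseteq> verts G \<and>
     (\<forall>L. L \<subseteq> verts G \<and> card L = min l (card (verts G)) \<longrightarrow>
        (leaky_psd_step G L)\<^sup>*\<^sup>* B (verts G))"

definition leaky_psd_forcing_number :: "('a, 'b) pre_digraph \<Rightarrow> nat \<Rightarrow> nat" where
  "leaky_psd_forcing_number G l = (LEAST k. \<exists>B. leaky_psd_forcing_set G l B \<and> card B = k)"

definition path_graph :: "nat \<Rightarrow> (nat, nat \<times> nat) pre_digraph" where
  "path_graph n = with_proj
     \<lparr> pverts = {1..n},
       parcs = {(i, j). i \<in> {1..n} \<and> j \<in> {1..n} \<and> (j = Suc i \<or> i = Suc j)} \<rparr>"

lemma graph_path_graph: "graph (path_graph n)"
proof -
  have "finite {(i, j). i \<in> {1..n} \<and> j \<in> {1..n} \<and> (j = Suc i \<or> i = Suc j)}"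
    by (rule finite_subset[of _ "{1..n} \<times> {1..n}"]) auto
  then show ?thesis
    unfolding path_graph_def
    by unfold_locales (auto simp: arc_to_ends_def symmetric_def sym_def)
qed

(* The minimum defining the number is over a nonempty set, hence attained. *)
lemma leaky_psd_forcing_set_verts: "leaky_psd_forcing_set G l (verts G)"
  by (simp add: leaky_psd_forcing_set_def)

lemma leaky_psd_forcing_number_attained:
  "\<exists>B. leaky_psd_forcing_set G l B \<and> card B = leaky_psd_forcing_number G l"
  unfolding leaky_psd_forcing_number_def
  by (rule LeastI_ex) (use leaky_psd_forcing_set_verts in blast)

end

theory Submission
  imports Defs
begin

(* A white vertex all of whose neighbours are leaks stays white, and no force happens when all blue
   vertices are leaks. On a path the first observation forces B to be everything as soon as l is at
   least 2, and the second gives card B > l unless B is everything. Conversely one end vertex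
   suffices without leaks, and the two ends suffice with one leak, since the blue segments grow from
   both ends up to the leak. *)

lemma arc_induce_subgraph_iff:
  "u \<rightarrow>\<^bsub>G \<restriction> S\<^esub> w \<longleftrightarrow>
     (\<exists>e \<in> arcs G. tail G e = u \<and> head G e = w) \<and> u \<in> S \<and> w \<in> S"
  by (auto simp: arcs_ends_def arc_to_ends_def induce_subgraph_def)

lemma arc_iff: "u \<rightarrow>\<^bsub>G\<^esub> w \<longleftrightarrow> (\<exists>e \<in> arcs G. tail G e = u \<and> head G e = w)"
  by (auto simp: arcs_ends_def arc_to_ends_def)

lemma psd_forceD:
  assumes "psd_force G B u w"
  shows "u \<in> B" "u \<rightarrow>\<^bsub>G\<^esub> w" "w \<notin> B"
proof -
  from assms obtain W where "u \<in> B" and W: "{x. u \<rightarrow>\<^bsub>G \<restriction> (W \<union> B)\<^esub> x \<and> x \<notin> B} = {w}"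
    by (auto simp: psd_force_def)
  then show "u \<in> B" by simp
  from W have "u \<rightarrow>\<^bsub>G \<restriction> (W \<union> B)\<^esub> w \<and> w \<notin> B"
    by blast
  then show "u \<rightarrow>\<^bsub>G\<^esub> w" "w \<notin> B"
    by (auto simp: arc_induce_subgraph_iff arc_iff)
qed

text \<open>Take the component of \<open>w\<close> as the component in the rule: restricting to it
  together with \<open>B\<close> keeps \<open>w\<close> and can only remove other white neighbours
  of \<open>u\<close>. All forces constructed below are of this kind, so components need not be
  computed.\<close>

lemma (in wf_digraph) psd_force_unique_white_neighbour:
  assumes "u \<in> B" and N: "{x. u \<rightarrow>\<^bsub>G\<^esub> x \<and> x \<notin> B} = {w}"
  shows "psd_force G B u w"
proof -
  let ?H = "G \<restriction> (verts G - B)"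
  interpret H: wf_digraph ?H
    by (rule wellformed_induce_subgraph)
  from N have w: "u \<rightarrow>\<^bsub>G\<^esub> w" "w \<notin> B" by blast+
  then have "w \<in> verts ?H"
    by (auto simp: adj_in_verts)
  then have "H.scc_of w \<in> components_outside G B" "w \<in> H.scc_of w"
    by (auto simp: components_outside_def H.scc_of_in_sccs_verts H.in_scc_of_self)
  moreover from this have "{x. u \<rightarrow>\<^bsub>G \<restriction> (H.scc_of w \<union> B)\<^esub> x \<and> x \<notin> B} = {w}"
    using N w \<open>u \<in> B\<close> by (auto simp: arc_induce_subgraph_iff arc_iff)
  ultimately show ?thesis
    using \<open>u \<in> B\<close> by (auto simp: psd_force_def)
qed

lemma leaky_psd_steps_keep_white:
  assumes "(leaky_psd_step G L)\<^sup>*\<^sup>* B C" and "v \<notin> B" and "{u. u \<rightarrow>\<^bsub>G\<^esub> v} \<subseteq> L"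
  shows "v \<notin> C"
  using assms(1)
proof induction
  case (step C D)
  then show ?case
    using assms(3) by (auto simp: leaky_psd_step_def dest: psd_forceD)
qed (fact assms(2))

lemma leaky_psd_steps_all_leaks:
  assumes "(leaky_psd_step G L)\<^sup>*\<^sup>* B C" and "B \<subseteq> L"
  shows "C = B"
  using assms(1)
proof induction
  case (step C D)
  then show ?case
    using assms(2) by (auto simp: leaky_psd_step_def dest: psd_forceD)
qed simp

text \<open>The definition prescribes the exact number of leaks. A smaller set \<open>A\<close> can
  be padded to that size, and the lower bounds only need that \<open>A\<close> consists of
  leaks.\<close>

lemma leaky_psd_forcing_setD:
  assumes "leaky_psd_forcing_set G l B" and "finite (verts G)"
    and "A \<subseteq> verts G" and "card A \<le> l"
  obtains L where "A \<subseteq> L" "(leaky_psd_step G L)\<^sup>*\<^sup>* B (verts G)"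
proof -
  have "card A \<le> min l (card (verts G))"
    using assms by (simp add: card_mono)
  then obtain L where "A \<subseteq> L" "L \<subseteq> verts G" "card L = min l (card (verts G))"
    using exists_subset_between[of A "min l (card (verts G))" "verts G"] assms by auto
  then show thesis
    using assms(1) that by (auto simp: leaky_psd_forcing_set_def)
qed

text \<open>Making all of \<open>A\<close> leaks would leave a white \<open>v\<close> with no
  neighbour able to force it. Allowing a superset \<open>A\<close> of the neighbourhood spares its
  exact computation.\<close>

lemma low_degree_in_leaky_psd_forcing_set:
  assumes "leaky_psd_forcing_set G l B" and "finite (verts G)"
    and "v \<in> verts G" and "{u. u \<rightarrow>\<^bsub>G\<^esub> v} \<subseteq> A" and "A \<subseteq> verts G" and "card A \<le> l"
  shows "v \<in> B"
proof (rule ccontr)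
  assume "v \<notin> B"
  from assms obtain L where "A \<subseteq> L" "(leaky_psd_step G L)\<^sup>*\<^sup>* B (verts G)"
    by (meson leaky_psd_forcing_setD)
  then show False
    using leaky_psd_steps_keep_white[of G L B "verts G" v] \<open>v \<notin> B\<close> assms by auto
qed

lemma less_card_leaky_psd_forcing_set:
  assumes "leaky_psd_forcing_set G l B" and "finite (verts G)" and "B \<noteq> verts G"
  shows "l < card B"
proof (rule ccontr)
  assume "\<not> l < card B"
  moreover have "B \<subseteq> verts G"
    using assms(1) by (simp add: leaky_psd_forcing_set_def)
  ultimately obtain L where "B \<subseteq> L" "(leaky_psd_step G L)\<^sup>*\<^sup>* B (verts G)"
    using assms by (meson leaky_psd_forcing_setD not_less)
  then show False
    using leaky_psd_steps_all_leaks assms(3) by metis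
qed

lemma leaky_psd_forcing_number_eqI:
  assumes "leaky_psd_forcing_set G l B" and "card B = k"
    and "\<And>C. leaky_psd_forcing_set G l C \<Longrightarrow> k \<le> card C"
  shows "leaky_psd_forcing_number G l = k"
  unfolding leaky_psd_forcing_number_def
proof (rule Least_equality)
  show "\<exists>B. leaky_psd_forcing_set G l B \<and> card B = k"
    using assms(1,2) by blast
  show "k \<le> m" if "\<exists>B. leaky_psd_forcing_set G l B \<and> card B = m" for m
    using assms(3) that by blast
qed

lemma verts_path_graph [simp]: "verts (path_graph n) = {1..n}"
  by (simp add: path_graph_def)

lemma arc_path_graph_iff:
  "u \<rightarrow>\<^bsub>path_graph n\<^esub> w \<longleftrightarrow> u \<in> {1..n} \<and> w \<in> {1..n} \<and> (w = Suc u \<or> u = Suc w)"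
  by (auto simp: path_graph_def arc_iff)

text \<open>If \<open>w\<close> is already blue, zero steps suffice. This allows a growing segment
  to run into vertices that are blue from the start.\<close>

lemma path_graph_step:
  assumes "u \<in> B" and "u \<notin> L" and "{x. u \<rightarrow>\<^bsub>path_graph n\<^esub> x} \<subseteq> insert w B"
    and "u \<rightarrow>\<^bsub>path_graph n\<^esub> w"
  shows "(leaky_psd_step (path_graph n) L)\<^sup>*\<^sup>* B (insert w B)"
proof (cases "w \<in> B")
  case False
  interpret graph "path_graph n" by (rule graph_path_graph)
  have "{x. u \<rightarrow>\<^bsub>path_graph n\<^esub> x \<and> x \<notin> B} = {w}"
    using False assms by auto
  then have "psd_force (path_graph n) B u w"
    using assms(1) by (rule psd_force_unique_white_neighbour[rotated])
  then show ?thesis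
    using assms(2) by (intro r_into_rtranclp) (auto simp: leaky_psd_step_def)
qed (simp add: insert_absorb)

text \<open>The endpoint \<open>a\<close> may be a leak, since only vertices before it have to
  force. The block \<open>{b..n}\<close> is carried along unchanged: it is empty for
  \<open>b = Suc n\<close> and the other end for \<open>b = n\<close>.\<close>

lemma path_graph_extend_initial_segment:
  assumes "1 \<le> a" and "a \<le> n" and "L \<inter> {1..<a} = {}"
  shows "(leaky_psd_step (path_graph n) L)\<^sup>*\<^sup>* ({1} \<union> {b..n}) ({1..a} \<union> {b..n})"
  using assms
proof (induction a rule: nat_induct_at_least)
  case (Suc a)
  then have "(leaky_psd_step (path_graph n) L)\<^sup>*\<^sup>* ({1} \<union> {b..n}) ({1..a} \<union> {b..n})"
    by (auto simp: atLeastLessThanSuc)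
  also have "(leaky_psd_step (path_graph n) L)\<^sup>*\<^sup>*
      ({1..a} \<union> {b..n}) (insert (Suc a) ({1..a} \<union> {b..n}))"
    \<comment> \<open>Vertex \<open>a\<close> forces \<open>Suc a\<close>, because its other
      neighbour, if any, lies in the blue segment.\<close>
    using Suc.hyps Suc.prems
    by (intro path_graph_step[of a]) (auto simp: arc_path_graph_iff atLeastLessThanSuc)
  also have "insert (Suc a) ({1..a} \<union> {b..n}) = {1..Suc a} \<union> {b..n}"
    by auto
  finally show ?case .
qed simp

text \<open>Mirror image, by induction downwards from \<open>n\<close>: \<open>Suc b\<close> forces
  \<open>b\<close>. Again the endpoint \<open>b\<close> may be a leak, and further blue vertices in
  \<open>A\<close> never obstruct a force.\<close>

lemma path_graph_extend_final_segment:
  assumes "b \<le> n" and "1 \<le> b" and "L \<inter> {b<..n} = {}"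
  shows "(leaky_psd_step (path_graph n) L)\<^sup>*\<^sup>* (A \<union> {n}) (A \<union> {b..n})"
  using assms
proof (induction b rule: inc_induct)
  case (step b)
  from step.prems have "L \<inter> {Suc b<..n} = {}" by auto
  then have "(leaky_psd_step (path_graph n) L)\<^sup>*\<^sup>* (A \<union> {n}) (A \<union> {Suc b..n})"
    using step.IH by simp
  also have "(leaky_psd_step (path_graph n) L)\<^sup>*\<^sup>*
      (A \<union> {Suc b..n}) (insert b (A \<union> {Suc b..n}))"
    using step.hyps step.prems
    by (intro path_graph_step[of "Suc b"]) (auto simp: arc_path_graph_iff)
  also have "insert b (A \<union> {Suc b..n}) = A \<union> {b..n}"
    using step.hyps by auto
  finally show ?case .
qed simp

lemma path_graph_forcing_set_0:
  assumes "n \<ge> 1"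
  shows "leaky_psd_forcing_set (path_graph n) 0 {1}"
  unfolding leaky_psd_forcing_set_def
proof (intro conjI allI impI)
  show "{1} \<subseteq> verts (path_graph n)"
    using assms by simp
  fix L assume L: "L \<subseteq> verts (path_graph n) \<and>
    card L = min 0 (card (verts (path_graph n)))"
  \<comment> \<open>Infinite sets also have cardinality 0, so finiteness is needed to conclude that
    \<open>L\<close> is empty.\<close>
  then have "finite L"
    using finite_subset by fastforce
  with L have "L = {}" by simp
  then show "(leaky_psd_step (path_graph n) L)\<^sup>*\<^sup>* {1} (verts (path_graph n))"
    using path_graph_extend_initial_segment[of n n L "Suc n"] assms by simp
qed

lemma path_graph_forcing_set_1:
  assumes "n \<ge> 1"
  shows "leaky_psd_forcing_set (path_graph n) 1 {1, n}"
  unfolding leaky_psd_forcing_set_def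
proof (intro conjI allI impI)
  show "{1, n} \<subseteq> verts (path_graph n)"
    using assms by simp
  fix L assume "L \<subseteq> verts (path_graph n) \<and>
    card L = min 1 (card (verts (path_graph n)))"
  then obtain v where v: "L = {v}" "1 \<le> v" "v \<le> n"
    using assms by (auto simp: card_1_singleton_iff)
  \<comment> \<open>Both segments grow up to and including the leak \<open>v\<close>, which is
    itself never asked to force.\<close>
  have "(leaky_psd_step (path_graph n) L)\<^sup>*\<^sup>* ({1} \<union> {n}) ({1..v} \<union> {n})"
    using v path_graph_extend_initial_segment[of v n L n] by simp
  also have "(leaky_psd_step (path_graph n) L)\<^sup>*\<^sup>* ({1..v} \<union> {n}) ({1..v} \<union> {v..n})"
    using v by (intro path_graph_extend_final_segment) auto
  finally show "(leaky_psd_step (path_graph n) L)\<^sup>*\<^sup>* {1, n} (verts (path_graph n))"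
    using v by (simp add: ivl_disj_un_two_touch insert_commute)
qed

lemma path_graph_forcing_set_ge_2:
  assumes "leaky_psd_forcing_set (path_graph n) l B" and "l \<ge> 2"
  shows "B = {1..n}"
proof
  show "B \<subseteq> {1..n}"
    using assms(1) by (simp add: leaky_psd_forcing_set_def)
  show "{1..n} \<subseteq> B"
  proof
    fix v assume v: "v \<in> {1..n}"
    \<comment> \<open>The intersection discards the non-vertices 0 (for \<open>v = 1\<close>) and
      \<open>Suc n\<close> (for \<open>v = n\<close>).\<close>
    have "card ({v - 1, Suc v} \<inter> {1..n}) \<le> card {v - 1, Suc v}"
      by (intro card_mono) auto
    also have "\<dots> \<le> l"
      using assms(2) by simp
    finally show "v \<in> B"
      using v by (intro low_degree_in_leaky_psd_forcing_set[OF assms(1),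
            where A = "{v - 1, Suc v} \<inter> {1..n}"]) (auto simp: arc_path_graph_iff)
  qed
qed

theorem theorem20:
  fixes n l :: nat
  assumes "n \<ge> 1" and "l = 1 \<longrightarrow> n \<ge> 2"
  shows "leaky_psd_forcing_number (path_graph n) l =
           (if l = 0 then 1 else if l = 1 then 2 else n)"
proof -
  \<comment> \<open>The second alternative is \<open>C\<close> being all vertices. There the bounds
    1 and 2 come from the assumptions on \<open>n\<close>; the path on one vertex would have value 1
    for \<open>l = 1\<close>.\<close>
  have lower: "l < card C \<or> card C = n" if "leaky_psd_forcing_set (path_graph n) l C" for C
    using less_card_leaky_psd_forcing_set[OF that] by fastforce
  consider "l = 0" | "l = 1" | "l \<ge> 2" by linarith
  then show ?thesis
  proof cases
    case 1
    then show ?thesis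
      using lower assms path_graph_forcing_set_0[of n]
      by (force intro!: leaky_psd_forcing_number_eqI[where B = "{1}"])
  next
    case 2
    then show ?thesis
      using lower assms path_graph_forcing_set_1[of n]
      by (force intro!: leaky_psd_forcing_number_eqI[where B = "{1, n}"])
  next
    case 3
    have "leaky_psd_forcing_number (path_graph n) l = n"
    proof (rule leaky_psd_forcing_number_eqI)
      show "leaky_psd_forcing_set (path_graph n) l {1..n}"
        using leaky_psd_forcing_set_verts[of "path_graph n" l] by simp
      show "n \<le> card C" if "leaky_psd_forcing_set (path_graph n) l C" for C
        using path_graph_forcing_set_ge_2[OF that 3] by simp
    qed simp
    with 3 show ?thesis by simp
  qed
qed

end
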